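(* Let $s_n$ denote the number of sparse paving matroids with ground set $\{1,\ldots,n\}$. Then $$\log\log s_n \le n - \frac{3}{2}\log n + \frac{1}{2}\log\frac{2}{\pi} + 1 + o(1)\qquad\text{as } n\to\infty.$$
   Context: $\log$ denotes the logarithm to base 2. Matroids are counted as labelled objects on the fixed ground set $\{1,\ldots,n\}$, not up to isomorphism. For a matroid $M$, $r(M)$ denotes its rank and $M^*$ its dual. $M$ is paving if $|C|\ge r(M)$ for each circuit $C$ of $M$; $M$ is sparse if $M^*$ is paving; $M$ is sparse paving if it is both sparse and paving. The term $o(1)$ denotes a function of $n$ tending to $0$ as $n\to\infty$. *)

theory Defs
  imports Complex_Main
begin

text \<open>
  A matroid with ground set \<open>E\<close> is represented by its family \<open>I\<close> of independent sets.
\<close>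

locale matroid =
  fixes E :: "'a set" and I :: "'a set set"
  assumes finite_ground: "finite E"
    and indep_subset_ground: "X \<in> I \<Longrightarrow> X \<subseteq> E"
    and indep_empty: "{} \<in> I"
    and indep_subset: "X \<in> I \<Longrightarrow> Y \<subseteq> X \<Longrightarrow> Y \<in> I"
    and augmentation:
      "X \<in> I \<Longrightarrow> Y \<in> I \<Longrightarrow> card X < card Y \<Longrightarrow> \<exists>y \<in> Y - X. insert y X \<in> I"

definition bases :: "'a set set \<Rightarrow> 'a set set" where
  "bases I = {B \<in> I. \<forall>X \<in> I. B \<subseteq> X \<longrightarrow> X = B}"

definition circuits :: "'a set \<Rightarrow> 'a set set \<Rightarrow> 'a set set" where
  "circuits E I = {C. C \<subseteq> E \<and> C \<notin> I \<and> (\<forall>D. D \<subset> C \<longrightarrow> D \<in> I)}"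

definition rank :: "'a set set \<Rightarrow> nat" where
  "rank I = Max (card ` I)"

text \<open>
  The dual is the matroid whose bases are the complements of the bases; the following is its
  family of independent sets.
\<close>

definition dual :: "'a set \<Rightarrow> 'a set set \<Rightarrow> 'a set set" where
  "dual E I = {X. \<exists>B \<in> bases I. X \<subseteq> E - B}"

definition paving :: "'a set \<Rightarrow> 'a set set \<Rightarrow> bool" where
  "paving E I \<longleftrightarrow> (\<forall>C \<in> circuits E I. rank I \<le> card C)"

definition sparse :: "'a set \<Rightarrow> 'a set set \<Rightarrow> bool" where
  "sparse E I \<longleftrightarrow> paving E (dual E I)"

definition sparse_paving :: "'a set \<Rightarrow> 'a set set \<Rightarrow> bool" where
  "sparse_paving E I \<longleftrightarrow> sparse E I \<and> paving E I"

definition num_sparse_paving :: "nat \<Rightarrow> nat" where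
  "num_sparse_paving n = card {I. matroid {1..n} I \<and> sparse_paving {1..n} I}"

lemma finite_sparse_paving_matroids: "finite {I. matroid {1..n::nat} I \<and> sparse_paving {1..n} I}"
  by (rule finite_subset[of _ "Pow (Pow {1..n})"]) (auto dest: matroid.indep_subset_ground)

end

theory Submission
  imports "HOL-Analysis.Gamma_Function" "HOL-Real_Asymp.Real_Asymp" Defs
begin

text \<open>
  A sparse paving matroid of rank \<open>r\<close> is determined by its dependent \<open>r\<close>-sets, and no two of these
  meet in \<open>r - 1\<close> elements.  They therefore form a stable set of the Johnson graph \<open>J(n,r)\<close>, whose
  vertices are the \<open>r\<close>-subsets of the ground set, two being adjacent when they meet in \<open>r - 1\<close>
  elements (\<open>sparse_paving_adjacent_basis\<close>, \<open>inj_on_rank_nonbases\<close>).  It remains to count stable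
  sets of \<open>J(n,r)\<close> for each of the \<open>n + 1\<close> values of \<open>r\<close>.

  With \<open>N = n choose r\<close>, a stable set has at most \<open>N / (n - r + 1)\<close> vertices: each of its members
  contains \<open>r\<close> sets of size \<open>r - 1\<close>, and no such set lies in two members.  Applying Cauchy--Schwarz to
  the same double count gives the robust form \<open>johnson_large_degree\<close>: a family of more than
  \<open>m = (1 + e) N / (n - r + 1)\<close> vertices spans a vertex adjacent to a fraction
  \<open>x = r (n - r + 1) e / ((1 + e) N)\<close> of the family.  (The same inequality follows from the least
  eigenvalue \<open>-r\<close> of \<open>J(n,r)\<close> for \<open>2 r \<le> n\<close>.)

  The inequality turns into a count as in the method of Kleitman and Winston.  Branch on whether a
  vertex of large degree belongs to the stable set.  If it does, a fraction \<open>x\<close> of the remaining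
  vertices disappears, so this happens only about \<open>p = O(log n / x)\<close> times before at most \<open>m\<close>
  vertices are left, and these contribute at most \<open>2 powr m\<close> choices.  The lemma
  \<open>card_stable_sets_bound\<close> encodes this as a one-line recursion, solved by
  \<open>2 powr m * (1 + N / m) powr p\<close>.

  Finally, \<open>N / (n - r + 1) = (n + 1 choose r) / (n + 1)\<close>.  If \<open>B\<close> denotes the largest binomial
  coefficient of order \<open>n + 1\<close>, then \<open>m \<le> (1 + e) B / (n + 1)\<close>, whereas \<open>p\<close> is of order at most
  \<open>B log n / (e n ^ 2)\<close>, uniformly in \<open>r\<close>.  With \<open>e\<close> about \<open>1 / sqrt n\<close>, the logarithm of the
  number of matroids is therefore at most \<open>(1 + o(1)) B / (n + 1)\<close>.
  By Wallis' product \<open>B \<le> 2 ^ (n + 1) * sqrt (2 / (pi * (n + 1)))\<close>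
  (\<open>binomial_upper_bound\<close>), and taking logarithms once more gives the stated expression.
\<close>

section \<open>Layers of the Boolean lattice and stable sets\<close>

definition layer :: "'a set \<Rightarrow> nat \<Rightarrow> 'a set set" where
  "layer E r = {X. X \<subseteq> E \<and> card X = r}"

text \<open>Adjacency in the Johnson graph on the \<open>r\<close>-sets; the additive form avoids the truncated
  \<open>r - 1\<close>, so that for \<open>r = 0\<close> nothing is adjacent.\<close>

definition johnson_adj :: "nat \<Rightarrow> 'a set \<Rightarrow> 'a set \<Rightarrow> bool" where
  "johnson_adj r X Y \<longleftrightarrow> card (X \<inter> Y) + 1 = r"

definition stable_sets :: "('v \<Rightarrow> 'v \<Rightarrow> bool) \<Rightarrow> 'v set \<Rightarrow> 'v set set" where
  "stable_sets R V = {S. S \<subseteq> V \<and> (\<forall>u \<in> S. \<forall>w \<in> S. \<not> R u w)}"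

lemma finite_layer [simp]: "finite E \<Longrightarrow> finite (layer E r)"
  by (rule finite_subset[of _ "Pow E"]) (auto simp: layer_def)

lemma card_layer: "finite E \<Longrightarrow> card (layer E r) = card E choose r"
  unfolding layer_def by (rule n_subsets)

lemma finite_stable_sets [simp]: "finite V \<Longrightarrow> finite (stable_sets R V)"
  by (rule finite_subset[of _ "Pow V"]) (auto simp: stable_sets_def)

section \<open>Sparse paving matroids as stable sets of Johnson graphs\<close>

context matroid
begin

lemma finite_indep: "X \<in> I \<Longrightarrow> finite X"
  using finite_ground finite_subset indep_subset_ground by blast

lemma finite_family: "finite I"
  by (rule finite_subset[of _ "Pow E"]) (use finite_ground indep_subset_ground in auto)

lemma card_indep_le_rank: "X \<in> I \<Longrightarrow> card X \<le> rank I"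
  unfolding rank_def using finite_family by (intro Max_ge) auto

lemma rank_attained: "\<exists>B \<in> I. card B = rank I"
proof -
  have "Max (card ` I) \<in> card ` I"
    using finite_family indep_empty by (intro Max_in) auto
  then show ?thesis unfolding rank_def by auto
qed

lemma rank_le_card_ground: "rank I \<le> card E"
  using rank_attained finite_ground indep_subset_ground by (metis card_mono)

lemma extend_to_full_rank:
  assumes "X \<in> I"
  shows "\<exists>B \<in> I. X \<subseteq> B \<and> card B = rank I"
  using assms
proof (induction "rank I - card X" arbitrary: X rule: less_induct)
  case less
  show ?case
  proof (cases "card X = rank I")
    case True
    with less.prems show ?thesis by blast
  next
    case False
    then have lt: "card X < rank I" using card_indep_le_rank[OF less.prems] by simp
    obtain R where R: "R \<in> I" "card R = rank I" using rank_attained by blast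
    obtain y where y: "y \<in> R - X" "insert y X \<in> I"
      using augmentation[OF less.prems R(1)] lt R(2) by auto
    have "card (insert y X) = Suc (card X)"
      using y finite_indep[OF less.prems] by simp
    then have "\<exists>B \<in> I. insert y X \<subseteq> B \<and> card B = rank I"
      using less.hyps[OF _ y(2)] lt by simp
    then show ?thesis by auto
  qed
qed

lemma bases_iff_full_rank: "B \<in> bases I \<longleftrightarrow> B \<in> I \<and> card B = rank I"
proof
  assume B: "B \<in> bases I"
  then have "B \<in> I" by (simp add: bases_def)
  with extend_to_full_rank B show "B \<in> I \<and> card B = rank I"
    unfolding bases_def by fastforce
next
  assume B: "B \<in> I \<and> card B = rank I"
  have "X = B" if "X \<in> I" "B \<subseteq> X" for X
    using card_subset_eq[OF finite_indep[OF that(1)] that(2)] card_indep_le_rank[OF that(1)]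
      card_mono[OF finite_indep[OF that(1)] that(2)] B by simp
  with B show "B \<in> bases I" by (auto simp: bases_def)
qed

text \<open>All bases have the same size, hence so do their complements, which are the maximal members of the
  dual family.\<close>

lemma rank_dual: "rank (dual E I) = card E - rank I"
proof -
  have le: "card X \<le> card E - rank I" if X: "X \<in> dual E I" for X
  proof -
    obtain B where "B \<in> bases I" and XB: "X \<subseteq> E - B"
      using X unfolding dual_def by blast
    then have "B \<in> I" "card B = rank I" by (simp_all add: bases_iff_full_rank)
    then have "card (E - B) = card E - rank I"
      using card_Diff_subset finite_indep indep_subset_ground by metis
    then show ?thesis using card_mono[OF _ XB] finite_ground by simp
  qed
  obtain B where B: "B \<in> I" "card B = rank I" using rank_attained by blast
  then have "card (E - B) = card E - rank I"
    using card_Diff_subset finite_indep indep_subset_ground by metis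
  moreover have "E - B \<in> dual E I" using B by (auto simp: dual_def bases_iff_full_rank)
  moreover have "finite (dual E I)"
    by (rule finite_subset[of _ "Pow E"]) (use finite_ground in \<open>auto simp: dual_def\<close>)
  ultimately show ?thesis unfolding rank_def[of "dual E I"]
    using le by (intro Max_eqI) (auto intro!: image_eqI[of _ card "E - B"])
qed

end

text \<open>A dependent set of least size inside \<open>X\<close> is a circuit.  The family \<open>I\<close> is arbitrary here, so that
  the lemma applies to the dual family as well.\<close>

lemma paving_imp_small_indep:
  assumes "finite E" "paving E I" "X \<subseteq> E" "card X < rank I"
  shows "X \<in> I"
proof (rule ccontr)
  assume "X \<notin> I"
  then obtain C where C: "C \<subseteq> X \<and> C \<notin> I"
    and least: "\<And>D. D \<subseteq> X \<and> D \<notin> I \<Longrightarrow> card C \<le> card D"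
    using ex_has_least_nat[of "\<lambda>C. C \<subseteq> X \<and> C \<notin> I" X card] by blast
  have finX: "finite X" using assms finite_subset by blast
  have "D \<in> I" if "D \<subset> C" for D
  proof (rule ccontr)
    assume "D \<notin> I"
    then have "card C \<le> card D" using least that C by blast
    moreover have "card D < card C"
      using psubset_card_mono that C finX finite_subset by metis
    ultimately show False by simp
  qed
  then have "C \<in> circuits E I" using C assms by (auto simp: circuits_def)
  then have "rank I \<le> card C" using assms by (auto simp: paving_def)
  also have "\<dots> \<le> card X" using C finX card_mono by blast
  finally show False using assms by simp
qed

text \<open>
  Since \<open>I\<close> is paving, \<open>X \<inter> Y\<close> is independent, being of size \<open>r - 1\<close>; since its dual is paving, the
  complement of \<open>X \<union> Y\<close> avoids some basis \<open>B\<close>, that is, \<open>B \<subseteq> X \<union> Y\<close>.  Augmenting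
  \<open>X \<inter> Y\<close> from \<open>B\<close> yields \<open>X\<close> or \<open>Y\<close>.
\<close>

lemma (in matroid) sparse_paving_adjacent_basis:
  assumes sp: "sparse_paving E I"
    and X: "X \<in> layer E (rank I)" and Y: "Y \<in> layer E (rank I)"
    and adj: "johnson_adj (rank I) X Y" and "X \<notin> I"
  shows "Y \<in> I"
proof -
  let ?r = "rank I"
  have fin: "finite X" "finite Y"
    using X Y finite_ground finite_subset by (auto simp: layer_def)
  have XY: "card (X \<inter> Y) + 1 = ?r" "card X = ?r" "card Y = ?r" "X \<subseteq> E" "Y \<subseteq> E"
    using adj X Y by (auto simp: johnson_adj_def layer_def)
  have meet: "X \<inter> Y \<in> I"
    using paving_imp_small_indep[of E I "X \<inter> Y"] sp finite_ground XY
    by (auto simp: sparse_paving_def)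
  have un: "card (X \<union> Y) = ?r + 1"
    using card_Un_Int[OF fin] XY by simp
  have "card (X \<union> Y) \<le> card E" using XY finite_ground by (intro card_mono) auto
  moreover have "card (E - (X \<union> Y)) = card E - card (X \<union> Y)"
    using fin XY by (intro card_Diff_subset) auto
  ultimately have "card (E - (X \<union> Y)) < rank (dual E I)"
    using un by (simp add: rank_dual)
  then have "E - (X \<union> Y) \<in> dual E I"
    using paving_imp_small_indep[of E "dual E I" "E - (X \<union> Y)"] sp finite_ground
    by (auto simp: sparse_paving_def sparse_def)
  then obtain B where B: "B \<in> I" "card B = ?r" "E - (X \<union> Y) \<subseteq> E - B"
    by (auto simp: dual_def bases_iff_full_rank)
  then have BXY: "B \<subseteq> X \<union> Y" using indep_subset_ground by blast
  obtain b where b: "b \<in> B - (X \<inter> Y)" "insert b (X \<inter> Y) \<in> I"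
    using augmentation[OF meet B(1)] B(2) XY by auto
  have cb: "card (insert b (X \<inter> Y)) = ?r" using b fin XY by simp
  consider "b \<in> X" | "b \<in> Y" using b BXY by blast
  then show ?thesis
  proof cases
    case 1
    then have "insert b (X \<inter> Y) = X" using cb fin XY by (intro card_subset_eq) auto
    with b \<open>X \<notin> I\<close> show ?thesis by simp
  next
    case 2
    then have "insert b (X \<inter> Y) = Y" using cb fin XY by (intro card_subset_eq) auto
    with b show ?thesis by simp
  qed
qed

definition rank_nonbases :: "'a set \<Rightarrow> 'a set set \<Rightarrow> nat \<times> 'a set set" where
  "rank_nonbases E I = (rank I, layer E (rank I) - I)"

text \<open>The bases are written as the rank layer minus the nonbases, so that the right-hand side depends
  on the image under \<open>rank_nonbases\<close> alone; injectivity is then immediate.\<close>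

lemma (in matroid) indep_iff_subset_basis:
  "X \<in> I \<longleftrightarrow> (\<exists>B \<in> layer E (rank I) - (layer E (rank I) - I). X \<subseteq> B)"
proof
  assume "X \<in> I"
  then obtain B where B: "B \<in> I" "X \<subseteq> B" "card B = rank I" using extend_to_full_rank by blast
  then have "B \<in> layer E (rank I)" using indep_subset_ground by (simp add: layer_def)
  with B show "\<exists>B \<in> layer E (rank I) - (layer E (rank I) - I). X \<subseteq> B" by blast
next
  assume "\<exists>B \<in> layer E (rank I) - (layer E (rank I) - I). X \<subseteq> B"
  then obtain B where "B \<in> I" "X \<subseteq> B" by blast
  then show "X \<in> I" by (rule indep_subset)
qed

lemma inj_on_rank_nonbases: "inj_on (rank_nonbases E) {I. matroid E I}"
proof (rule inj_onI)
  fix I J assume "I \<in> {I. matroid E I}" "J \<in> {I. matroid E I}"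
    and eq: "rank_nonbases E I = rank_nonbases E J"
  then have "matroid E I" "matroid E J" by auto
  note iff = this[THEN matroid.indep_iff_subset_basis]
  have r: "rank I = rank J" and l: "layer E (rank J) - I = layer E (rank J) - J"
    using eq unfolding rank_nonbases_def by (metis prod.inject)+
  have "X \<in> I \<longleftrightarrow> X \<in> J" for X
    unfolding iff(1)[of X] iff(2)[of X] r l by (rule refl)
  then show "I = J" by blast
qed

lemma rank_nonbases_stable:
  assumes "matroid E I" "sparse_paving E I"
  shows "rank_nonbases E I \<in> (SIGMA r:{..card E}. stable_sets (johnson_adj r) (layer E r))"
proof -
  interpret matroid E I by fact
  have "layer E (rank I) - I \<in> stable_sets (johnson_adj (rank I)) (layer E (rank I))"
    using sparse_paving_adjacent_basis[OF assms(2)] unfolding stable_sets_def by blast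
  then show ?thesis
    using rank_le_card_ground by (simp add: rank_nonbases_def)
qed

lemma num_sparse_paving_le:
  "num_sparse_paving n \<le>
    (\<Sum>r\<le>n. card (stable_sets (johnson_adj r) (layer {1..n} r)))"
proof -
  let ?M = "{I. matroid {1..n} I \<and> sparse_paving {1..n} I}"
  let ?T = "SIGMA r:{..n}. stable_sets (johnson_adj r) (layer {1..n} r)"
  have "card ?M \<le> card ?T"
  proof (rule card_inj_on_le)
    show "inj_on (rank_nonbases {1..n}) ?M"
      by (rule inj_on_subset[OF inj_on_rank_nonbases]) auto
    show "rank_nonbases {1..n} ` ?M \<subseteq> ?T"
    proof (rule image_subsetI)
      fix I assume "I \<in> ?M"
      then show "rank_nonbases {1..n} I \<in> ?T"
        using rank_nonbases_stable[of "{1..n}" I] by simp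
    qed
    show "finite ?T" by auto
  qed
  then show ?thesis by (simp add: num_sparse_paving_def)
qed

section \<open>Stable sets of locally dense graphs\<close>

text \<open>The stable sets without \<open>v\<close> live on \<open>V - {v}\<close>, those containing \<open>v\<close> are determined by their
  trace on the non-neighbours of \<open>v\<close>.\<close>

lemma card_stable_sets_delete:
  assumes "finite V"
  shows "card (stable_sets R V) \<le>
    card (stable_sets R (V - {v})) + card (stable_sets R {w \<in> V - {v}. \<not> R v w})"
proof -
  let ?D = "{w \<in> V - {v}. \<not> R v w}"
  have "S \<in> stable_sets R (V - {v}) \<union> insert v ` stable_sets R ?D" if "S \<in> stable_sets R V" for S
  proof (cases "v \<in> S")
    case True
    have "S - {v} \<in> stable_sets R ?D" using that True by (auto simp: stable_sets_def)
    moreover have "S = insert v (S - {v})" using True by blast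
    ultimately show ?thesis by (intro UnI2 image_eqI)
  qed (use that in \<open>auto simp: stable_sets_def\<close>)
  then have "card (stable_sets R V) \<le>
      card (stable_sets R (V - {v}) \<union> insert v ` stable_sets R ?D)"
    using assms by (intro card_mono) auto
  also have "\<dots> \<le> card (stable_sets R (V - {v})) + card (insert v ` stable_sets R ?D)"
    by (rule card_Un_le)
  also have "\<dots> \<le> card (stable_sets R (V - {v})) + card (stable_sets R ?D)"
    using assms by (intro add_left_mono card_image_le) auto
  finally show ?thesis .
qed

text \<open>Since \<open>1 - c \<le> exp (- c)\<close>, relative decreases of a potential become exponential factors for its
  powers.\<close>

lemma shrink_powr:
  fixes u u' c p :: real
  assumes "0 < u'" "0 < u" "u' \<le> u * (1 - c)" "0 \<le> p"
  shows "u' powr p \<le> u powr p * exp (- (c * p))"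
proof -
  have "u' \<le> u * exp (- c)"
    using assms exp_ge_add_one_self[of "-c"]
    by (smt (verit) mult_left_mono)
  then have "u' powr p \<le> (u * exp (- c)) powr p"
    using assms by (intro powr_mono2) auto
  also have "\<dots> = u powr p * exp (- (c * p))"
    using assms by (simp add: powr_mult exp_powr_real)
  finally show ?thesis .
qed

text \<open>
  Induction on \<open>V\<close>, branching at a vertex of large degree.  The potential \<open>u = 1 + card V / m\<close> drops by
  a factor \<open>1 - 1 / t\<close> or better when the vertex is deleted, and by a factor \<open>1 - x / 2\<close> or better
  when its neighbourhood goes too; the hypothesis on \<open>p\<close> says that the \<open>p\<close>-th powers of the two
  smaller potentials add up to at most that of \<open>u\<close>.  The summand \<open>1\<close> in the potential keeps it
  at least \<open>1\<close> when a branch falls below \<open>m\<close> vertices, where the trivial bound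
  \<open>2 ^ card V\<close> takes over.
\<close>

lemma card_stable_sets_bound:
  fixes m x p t :: real
  assumes "finite V" and m: "0 < m" and p: "0 \<le> p" and x: "0 \<le> x"
    and deg: "\<And>A. A \<subseteq> V \<Longrightarrow> m < card A \<Longrightarrow> \<exists>v \<in> A. x * card A \<le> card {w \<in> A. R v w}"
    and t: "m + card V \<le> t"
    and decay: "exp (- (p / t)) + exp (- (x * p / 2)) \<le> 1"
  shows "card (stable_sets R V) \<le> 2 powr m * (1 + card V / m) powr p"
  using assms(1) deg t
proof (induction V rule: finite_psubset_induct)
  case (psubset V)
  show ?case
  proof (cases "m < card V")
    case False
    have "card (stable_sets R V) \<le> card (Pow V)"
      using psubset.hyps by (intro card_mono) (auto simp: stable_sets_def)
    then have "real (card (stable_sets R V)) \<le> 2 powr card V"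
      using psubset.hyps by (simp add: card_Pow powr_realpow)
    also have "\<dots> \<le> 2 powr m" using False by simp
    also have "\<dots> \<le> 2 powr m * (1 + card V / m) powr p"
      using m p by (simp add: ge_one_powr_ge_zero)
    finally show ?thesis .
  next
    case True
    then obtain v where v: "v \<in> V" and dv: "x * card V \<le> card {w \<in> V. R v w}"
      using psubset.prems by blast
    let ?D = "{w \<in> V - {v}. \<not> R v w}"
    define u where "u = 1 + card V / m"
    have u: "u > 0" "u * m = m + card V" using m by (simp_all add: u_def field_simps add_pos_nonneg)
    have IH: "card (stable_sets R W) \<le> 2 powr m * (1 + card W / m) powr p" if "W \<subset> V" for W
    proof (rule psubset.IH[OF that])
      show "m + card W \<le> t"
        using psubset.prems(2) card_mono[OF psubset.hyps, of W] that by force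
    qed (use psubset.prems(1) that in blast)
    have "1 / t \<le> 1 / (u * m)"
      using psubset.prems(2) u m by (intro divide_left_mono) (auto intro!: mult_pos_pos add_pos_nonneg)
    then have del1: "1 + card (V - {v}) / m \<le> u * (1 - 1 / t)"
    proof -
      assume "1 / t \<le> 1 / (u * m)"
      then have "u * (1 / t) \<le> u * (1 / (u * m))" using u by (intro mult_left_mono) auto
      also have "\<dots> = 1 / m" using u(1) m by simp
      finally have "u * (1 / t) \<le> 1 / m" .
      moreover have "real (card (V - {v})) = real (card V) - 1"
        using card_Suc_Diff1[OF psubset.hyps v] by linarith
      then have "1 + card (V - {v}) / m = u - 1 / m"
        by (simp add: u_def diff_divide_distrib)
      ultimately show ?thesis by (simp add: right_diff_distrib)
    qed
    have del2: "1 + card ?D / m \<le> u * (1 - x / 2)"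
    proof -
      have "card ?D \<le> card (V - {w \<in> V. R v w})"
        using psubset.hyps by (intro card_mono) auto
      also have "\<dots> = card V - card {w \<in> V. R v w}"
        using psubset.hyps by (intro card_Diff_subset) auto
      finally have "real (card ?D) \<le> real (card V) - card {w \<in> V. R v w}"
        using card_mono[OF psubset.hyps, of "{w \<in> V. R v w}"] by simp
      then have "real (card ?D) \<le> real (card V) - x * card V" using dv by simp
      then have "card ?D / m \<le> (real (card V) - x * card V) / m"
        using m by (intro divide_right_mono) auto
      then have "1 + card ?D / m \<le> u - x * (card V / m)"
        by (simp add: u_def diff_divide_distrib)
      (* this is where the half in 1 - x / 2 comes from: card V > m, so the summand 1 is at most half of u *)
      moreover have "u / 2 \<le> card V / m" using True m by (simp add: u_def field_simps)
      then have "x * (u / 2) \<le> x * (card V / m)" using x by (rule mult_left_mono)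
      moreover have "u * (1 - x / 2) = u - x * (u / 2)" by (simp add: algebra_simps)
      ultimately show ?thesis by linarith
    qed
    have "real (card (stable_sets R V)) \<le>
        real (card (stable_sets R (V - {v}))) + real (card (stable_sets R ?D))"
      using card_stable_sets_delete[OF psubset.hyps, of R v] by linarith
    also have "\<dots> \<le> 2 powr m * (1 + card (V - {v}) / m) powr p
        + 2 powr m * (1 + card ?D / m) powr p"
      using v by (intro add_mono IH) auto
    also have "\<dots> \<le> 2 powr m * (u powr p * exp (- (1 / t * p)))
        + 2 powr m * (u powr p * exp (- (x / 2 * p)))"
      using m p u del1 del2
      by (intro add_mono mult_left_mono shrink_powr) (auto intro!: add_pos_nonneg)
    also have "\<dots> = 2 powr m * u powr p * (exp (- (p / t)) + exp (- (x * p / 2)))"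
      by (simp add: algebra_simps)
    also have "\<dots> \<le> 2 powr m * u powr p * 1"
      using decay by (intro mult_left_mono) auto
    finally show ?thesis by (simp add: u_def)
  qed
qed

section \<open>Large degrees in Johnson graphs\<close>

text \<open>
  Count pairs \<open>T \<subseteq> X\<close> with \<open>X \<in> A\<close> and \<open>card T = r - 1\<close>, and let \<open>f T\<close> be the number of
  members of \<open>A\<close> above \<open>T\<close>.  Then \<open>f\<close> sums to \<open>r * card A\<close>, while its square sums to the number of
  triples \<open>T \<subseteq> X \<inter> Y\<close>.  A given \<open>X\<close> lies in \<open>r\<close> triples with \<open>Y = X\<close> and one
  for each neighbour \<open>Y\<close>.  Cauchy--Schwarz compares the two sums, and some \<open>X\<close> is at least
  as good as the average.
\<close>

lemma johnson_large_degree: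
  assumes "finite E" and A: "A \<subseteq> layer E r" "A \<noteq> {}" and r: "1 \<le> r"
  shows "\<exists>X \<in> A. r\<^sup>2 * card A \<le>
    (card E choose (r - 1)) * (r + card {Y \<in> A. johnson_adj r X Y})"
proof (rule ccontr)
  assume contra: "\<not> ?thesis"
  let ?T = "layer E (r - 1)" and ?deg = "\<lambda>X. card {Y \<in> A. johnson_adj r X Y}"
  have finA: "finite A" using A assms(1) finite_subset finite_layer by blast
  have choose_pred: "r choose (r - 1) = r" using r by (cases r) simp_all
  have inE: "X \<subseteq> E" "finite X" "card X = r" if "X \<in> A" for X
    using subsetD[OF A(1) that] assms(1) by (auto simp: layer_def intro: finite_subset)
  have count: "(\<Sum>T \<in> ?T. of_bool (T \<subseteq> Z)) = real (card Z choose (r - 1))"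
    if "Z \<subseteq> E" for Z
  proof -
    have "?T \<inter> {T. T \<subseteq> Z} = layer Z (r - 1)" using that by (auto simp: layer_def)
    moreover have "finite Z" using that assms(1) by (rule finite_subset)
    ultimately show ?thesis
      using assms(1) by (simp add: sum_of_bool_eq card_layer)
  qed
  have sum1: "(\<Sum>T \<in> ?T. \<Sum>X \<in> A. of_bool (T \<subseteq> X)) = real (r * card A)"
  proof -
    have "(\<Sum>T \<in> ?T. \<Sum>X \<in> A. of_bool (T \<subseteq> X)) = (\<Sum>X \<in> A. real (card X choose (r - 1)))"
      by (subst sum.swap) (intro sum.cong refl count inE)
    also have "\<dots> = (\<Sum>X \<in> A. real r)"
      by (intro sum.cong refl) (simp add: inE choose_pred del: One_nat_def)
    finally show ?thesis by simp
  qed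
  have pairs: "(\<Sum>Y \<in> A. real (card (X \<inter> Y) choose (r - 1))) = r + ?deg X" if X: "X \<in> A" for X
  proof -
    have "real (card (X \<inter> Y) choose (r - 1)) = (if Y = X then real r else 0) + of_bool (johnson_adj r X Y)"
      if Y: "Y \<in> A" for Y
    proof (cases "Y = X")
      case True
      then show ?thesis using inE[OF X] by (simp add: johnson_adj_def choose_pred del: One_nat_def)
    next
      case False
      then have "\<not> X \<subseteq> Y"
        using inE[OF X] inE[OF Y] card_subset_eq[of Y X] by auto
      then have "X \<inter> Y \<subset> X" by blast
      then have "card (X \<inter> Y) < r" using inE[OF X] psubset_card_mono by metis
      then consider "card (X \<inter> Y) = r - 1" | "card (X \<inter> Y) < r - 1" by linarith
      then show ?thesis using False r by cases (auto simp: johnson_adj_def binomial_eq_0)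
    qed
    then have "(\<Sum>Y \<in> A. real (card (X \<inter> Y) choose (r - 1)))
        = (\<Sum>Y \<in> A. (if Y = X then real r else 0) + of_bool (johnson_adj r X Y))"
      by (intro sum.cong) auto
    also have "\<dots> = r + ?deg X"
      using X finA by (simp add: sum.distrib sum_of_bool_eq Int_def)
    finally show ?thesis .
  qed
  have sum2: "(\<Sum>T \<in> ?T. (\<Sum>X \<in> A. of_bool (T \<subseteq> X))\<^sup>2) = (\<Sum>X \<in> A. real (r + ?deg X))"
  proof -
    have "(\<Sum>T \<in> ?T. (\<Sum>X \<in> A. of_bool (T \<subseteq> X))\<^sup>2)
        = (\<Sum>T \<in> ?T. \<Sum>X \<in> A. \<Sum>Y \<in> A. of_bool (T \<subseteq> X \<inter> Y) :: real)"
      by (simp add: power2_eq_square sum_product flip: of_bool_conj)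
    also have "\<dots> = (\<Sum>X \<in> A. \<Sum>T \<in> ?T. \<Sum>Y \<in> A. of_bool (T \<subseteq> X \<inter> Y))"
      by (rule sum.swap)
    also have "\<dots> = (\<Sum>X \<in> A. \<Sum>Y \<in> A. \<Sum>T \<in> ?T. of_bool (T \<subseteq> X \<inter> Y))"
      by (intro sum.cong refl sum.swap)
    also have "\<dots> = (\<Sum>X \<in> A. \<Sum>Y \<in> A. real (card (X \<inter> Y) choose (r - 1)))"
      using inE by (intro sum.cong refl count) blast
    also have "\<dots> = (\<Sum>X \<in> A. real (r + ?deg X))"
      by (intro sum.cong refl pairs)
    finally show ?thesis .
  qed
  have "(real (r * card A))\<^sup>2 \<le> card ?T * (\<Sum>X \<in> A. real (r + ?deg X))"
    using sum_squared_le_sum_of_squares[of "\<lambda>T. \<Sum>X \<in> A. of_bool (T \<subseteq> X)" ?T] assms(1)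
    by (simp only: sum1 sum2)
       (simp add: mult.commute)
  also have "\<dots> = (\<Sum>X \<in> A. real ((card E choose (r - 1)) * (r + ?deg X)))"
    by (simp add: card_layer[OF assms(1)] sum_distrib_left)
  also have "\<dots> < (\<Sum>X \<in> A. real (r\<^sup>2 * card A))"
    using contra finA A(2) by (intro sum_strict_mono) (auto simp: not_le simp del: of_nat_mult of_nat_add)
  also have "\<dots> = (real (r * card A))\<^sup>2" by (simp add: power2_eq_square)
  finally show False by simp
qed

section \<open>The largest binomial coefficient\<close>

lemma central_binomial_Suc:
  "real (2 * Suc n choose Suc n) = real (2 * n choose n) * (2 * (2 * n + 1)) / (n + 1)"
proof -
  have s: "Suc (2 * n + 1) = 2 * Suc n" by simp
  have "2 * Suc n * (2 * n + 1 choose n) = (2 * Suc n choose Suc n) * Suc n"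
    using Suc_times_binomial_eq[of "2 * n + 1" n] unfolding s .
  then have 1: "real (2 * Suc n) * real (2 * n + 1 choose n) = real (2 * Suc n choose Suc n) * real (Suc n)"
    by (metis of_nat_mult)
  have "(n + 1) * (2 * n + 1 choose n) = (2 * n + 1) * (2 * n choose n)"
    using binomial_absorb_comp[of "2 * n + 1" n] by (simp del: binomial_Suc_Suc)
  then have 2: "real (n + 1) * real (2 * n + 1 choose n) = real (2 * n + 1) * real (2 * n choose n)"
    by (metis of_nat_mult)
  define c a b where "c = real (2 * Suc n choose Suc n)" and "a = real (2 * n + 1 choose n)"
    and "b = real (2 * n choose n)"
  have "c * (n + 1) = b * (2 * (2 * n + 1))"
    using 1 2 unfolding c_def[symmetric] a_def[symmetric] b_def[symmetric]
    by (simp add: algebra_simps)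
  then have "c = b * (2 * (2 * n + 1)) / (n + 1)" by (simp add: field_simps)
  then show ?thesis unfolding c_def b_def .
qed

text \<open>The partial Wallis products, and hence their limit, are expressed by central binomial
  coefficients.\<close>

lemma wallis_product_eq:
  "(\<Prod>k=1..n. (4 * real k ^ 2) / (4 * real k ^ 2 - 1)) * (real (2 * n choose n))\<^sup>2 * (2 * n + 1)
    = 16 ^ n"
proof (induction n)
  case (Suc n)
  have ne: "4 * real (Suc n) ^ 2 - 1 = (2 * n + 1) * (2 * n + 3)"
    by (simp add: power2_eq_square algebra_simps)
  have "(\<Prod>k=1..Suc n. (4 * real k ^ 2) / (4 * real k ^ 2 - 1)) * (real (2 * Suc n choose Suc n))\<^sup>2
      * (2 * Suc n + 1)
    = (\<Prod>k=1..n. (4 * real k ^ 2) / (4 * real k ^ 2 - 1)) * (real (2 * n choose n))\<^sup>2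
      * ((4 * real (Suc n) ^ 2) / ((2 * n + 1) * (2 * n + 3)) * ((2 * (2 * n + 1)) / (n + 1))\<^sup>2
      * (2 * n + 3))"
  proof -
    have le: "1 \<le> Suc n" by simp
    have "(\<Prod>k=1..Suc n. (4 * real k ^ 2) / (4 * real k ^ 2 - 1))
        = (\<Prod>k=1..n. (4 * real k ^ 2) / (4 * real k ^ 2 - 1))
          * ((4 * real (Suc n) ^ 2) / ((2 * n + 1) * (2 * n + 3)))"
      unfolding ne[symmetric] by (subst prod.nat_ivl_Suc'[OF le]) (rule mult.commute)
    moreover have "(real (2 * Suc n choose Suc n))\<^sup>2
        = (real (2 * n choose n))\<^sup>2 * ((2 * (2 * n + 1)) / (n + 1))\<^sup>2"
      unfolding central_binomial_Suc by (simp only: power_mult_distrib times_divide_eq_right[symmetric])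
    moreover have "real (2 * Suc n + 1) = 2 * n + 3" by simp
    ultimately show ?thesis by (simp only: mult_ac)
  qed
  also have "(4 * real (Suc n) ^ 2) / ((2 * n + 1) * (2 * n + 3)) * ((2 * (2 * n + 1)) / (n + 1))\<^sup>2
      * (2 * n + 3) = 16 * (2 * real n + 1)"
  proof -
    have "0 < 3 + (real n * 8 + real n * (real n * 4))" by (intro add_pos_nonneg) auto
    then show ?thesis by (simp add: power2_eq_square divide_simps) (simp add: algebra_simps)
  qed
  also have "(\<Prod>k=1..n. (4 * real k ^ 2) / (4 * real k ^ 2 - 1)) * (real (2 * n choose n))\<^sup>2
      * (16 * (2 * real n + 1)) = 16 * 16 ^ n"
    using Suc.IH by (simp add: algebra_simps)
  finally show ?case by simp
qed simp

text \<open>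
  By \<open>wallis_product_eq\<close>, the square of \<open>4 ^ n / (2 * n choose n)\<close> is \<open>W n * (2 * n + 1)\<close>, where \<open>W\<close> is the
  partial Wallis product.  The products themselves increase to \<open>pi / 2\<close> and so bound the binomial
  coefficient from below; multiplied by \<open>(2 * n + 1) / (2 * n)\<close> they decrease to the same limit,
  which gives the bound from above.
\<close>

lemma central_binomial_upper_bound:
  assumes "0 < n"
  shows "real (2 * n choose n) \<le> 4 ^ n / sqrt (pi * n)"
proof -
  define W where "W = (\<lambda>n. \<Prod>k=1..n. (4 * real k ^ 2) / (4 * real k ^ 2 - 1))"
  (* shifted by one, since the factor (2 * n + 1) / (2 * n) is meaningless at n = 0 *)
  define V where "V = (\<lambda>n. W (Suc n) * ((2 * real n + 3) / (2 * real n + 2)))"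
  have Wpos: "0 < W n" for n
  proof -
    have "0 < 4 * real k ^ 2 - 1" if "k \<ge> 1" for k :: nat
    proof -
      have "1 \<le> real k ^ 2" using that by simp
      then show ?thesis by linarith
    qed
    then show ?thesis unfolding W_def by (intro prod_pos) auto
  qed
  have "decseq V"
  proof (rule decseq_SucI)
    fix n
    have ne: "4 * real (Suc (Suc n)) ^ 2 - 1 = (2 * n + 3) * (2 * n + 5)"
      by (simp add: power2_eq_square algebra_simps)
    have "V (Suc n) = W (Suc n) * ((4 * (real n + 2) ^ 2) / ((2 * n + 3) * (2 * n + 5))
        * ((2 * real n + 5) / (2 * real n + 4)))"
      unfolding V_def W_def prod.nat_ivl_Suc'[of 1 "Suc n", simplified] using ne
      by (simp add: add_ac)
    also have "\<dots> \<le> W (Suc n) * ((2 * real n + 3) / (2 * real n + 2))"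
    proof (rule mult_left_mono)
      show "4 * (real n + 2) ^ 2 / ((2 * n + 3) * (2 * n + 5)) * ((2 * real n + 5) / (2 * real n + 4))
        \<le> (2 * real n + 3) / (2 * real n + 2)"
        by (simp add: power2_eq_square divide_simps) (simp add: algebra_simps)
    qed (use Wpos less_imp_le in blast)
    finally show "V (Suc n) \<le> V n" by (simp add: V_def)
  qed
  moreover have "V \<longlonglongrightarrow> pi / 2 * 1"
    unfolding V_def
  proof (rule tendsto_mult)
    show "(\<lambda>n. W (Suc n)) \<longlonglongrightarrow> pi / 2"
      using wallis unfolding W_def by (rule LIMSEQ_Suc)
    show "(\<lambda>n. (2 * real n + 3) / (2 * real n + 2)) \<longlonglongrightarrow> 1" by real_asymp
  qed
  ultimately have "pi / 2 * 1 \<le> V (n - 1)" by (rule decseq_ge)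
  then have "pi / 2 \<le> W n * ((2 * n + 1) / (2 * n))"
    using assms by (simp add: V_def of_nat_diff)
  then have "pi * n * (real (2 * n choose n))\<^sup>2
      \<le> (W n * ((2 * n + 1) / (2 * n))) * (2 * n) * (real (2 * n choose n))\<^sup>2"
  proof (intro mult_right_mono)
    assume *: "pi / 2 \<le> W n * ((2 * n + 1) / (2 * n))"
    have "pi * n = pi / 2 * (2 * n)" by simp
    also have "\<dots> \<le> (W n * ((2 * n + 1) / (2 * n))) * (2 * n)"
      by (rule mult_right_mono[OF *]) simp
    finally show "pi * n \<le> (W n * ((2 * n + 1) / (2 * n))) * (2 * n)" .
  qed simp
  also have "\<dots> = W n * (real (2 * n choose n))\<^sup>2 * (2 * n + 1)" using assms by simp
  also have "\<dots> = (4 ^ n)\<^sup>2"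
    using wallis_product_eq[of n] by (simp add: W_def power2_eq_square flip: power_mult_distrib)
  finally have "(real (2 * n choose n))\<^sup>2 \<le> (4 ^ n)\<^sup>2 / (pi * n)"
    using assms by (simp add: field_simps)
  also have "\<dots> = (4 ^ n / sqrt (pi * n))\<^sup>2" using assms by (simp add: power_divide)
  finally show ?thesis by (rule power2_le_imp_le) simp
qed

lemma binomial_upper_bound:
  assumes "0 < n"
  shows "real (n choose k) \<le> 2 ^ n * sqrt (2 / (pi * n))"
proof -
  have "real (n choose k) \<le> n choose (n div 2)"
    using binomial_maximum by simp
  also have "\<dots> \<le> 2 ^ n * sqrt (2 / (pi * n))"
  proof (cases "even n")
    case True
    then obtain j where j: "n = 2 * j" by blast
    have "real (2 * j choose j) \<le> 4 ^ j / sqrt (pi * j)"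
      using assms j by (intro central_binomial_upper_bound) simp
    also have "\<dots> = 2 ^ n * sqrt (2 / (pi * n))"
    proof -
      have "(2::real) ^ n = 4 ^ j" unfolding j by (simp add: power_mult)
      then show ?thesis using j by (simp add: real_sqrt_divide)
    qed
    finally show ?thesis using j by simp
  next
    case False
    then obtain j where j: "n = 2 * j + 1" using oddE by blast
    have "2 * real (n choose j) = real (2 * Suc j choose Suc j)"
      using binomial_symmetric[of "Suc j" "2 * j + 1"] j by simp
    also have "\<dots> \<le> 4 ^ Suc j / sqrt (pi * Suc j)"
      by (intro central_binomial_upper_bound) simp
    also have "\<dots> = 2 * (2 ^ n * sqrt (2 / (pi * (2 * Suc j))))"
    proof -
      have "(2::real) ^ n = 2 * 4 ^ j" unfolding j by (simp add: power_mult)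
      moreover have "2 / (pi * (2 * Suc j)) = 1 / (pi * Suc j)"
        by (simp only: of_nat_mult of_nat_numeral) (simp del: of_nat_Suc)
      ultimately show ?thesis by (simp only: real_sqrt_divide) simp
    qed
    also have "\<dots> \<le> 2 * (2 ^ n * sqrt (2 / (pi * n)))"
      using j by (intro mult_left_mono real_sqrt_le_mono divide_left_mono mult_left_mono) auto
    finally show ?thesis using j by simp
  qed
  finally show ?thesis .
qed

section \<open>The number of sparse paving matroids\<close>

text \<open>
  In \<open>card_stable_sets_bound\<close>, \<open>m\<close> is the bound \<open>N / D\<close> on the size of a stable set times \<open>1 + e\<close>,
  \<open>x\<close> is the relative degree that \<open>johnson_large_degree\<close> then provides, and \<open>p = 2 * L / x\<close>
  makes the second exponential in the decay condition equal to \<open>exp (- L)\<close>.  The first one is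
  \<open>exp (- y)\<close> with \<open>y\<close> at least of order \<open>1 / n ^ 2\<close>, so \<open>exp L = (n + 2) ^ 3\<close> suffices.

  Both \<open>m\<close> and \<open>p\<close> are compared with \<open>B\<close> by absorption identities: dividing \<open>n choose r\<close> by
  \<open>n - r + 1\<close> raises the upper index by one and gains a factor \<open>n + 1\<close>, and dividing once more by \<open>r\<close> raises
  both indices and gains at least \<open>(n + 2) / 2\<close>.  This makes the bound uniform in \<open>r\<close>.
\<close>

lemma card_johnson_stable_sets:
  fixes e B :: real
  assumes r: "1 \<le> r" "r \<le> n" and e: "0 < e" "e \<le> 1"
    and B: "\<And>k. real (n + 1 choose k) \<le> B"
  shows "card (stable_sets (johnson_adj r) (layer {1..n} r)) \<le>
    2 powr (B / (n + 1) * (1 + e + 48 * ln (n + 2) * log 2 (n + 1) / (e * (n + 2))))"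
proof -
  define N D where "N = real (n choose r)" and "D = real (n - r + 1)"
  define m x L where "m = (1 + e) * N / D" and "x = r * D * e / ((1 + e) * N)"
    and "L = 3 * ln (real n + 2)"
  define p where "p = 2 * L / x"
  have N: "0 < N" using r by (simp add: N_def)
  have D: "1 \<le> D" "D \<le> n" using r by (auto simp: D_def)
  have pos: "0 < real r" "0 < m" "0 < x" using N D r e by (auto simp: m_def x_def)
  have L: "3 \<le> L"
  proof -
    have "ln (exp 1) \<le> ln (real n + 2)"
      using exp_le r by (subst ln_le_cancel_iff) auto
    then show ?thesis by (simp add: L_def)
  qed
  have p: "0 \<le> p" using L pos by (simp add: p_def)
  have below: "real (n choose (r - 1)) * D = r * N"
  proof -
    obtain k where k: "r = Suc k" using r by (cases r) auto
    have "(n - k) * (n choose k) = Suc k * (n choose Suc k)"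
      by (simp only: binomial_absorb_comp binomial_absorption)
    then have "real (n - k) * real (n choose k) = real (Suc k) * real (n choose Suc k)"
      by (metis of_nat_mult)
    moreover have "D = real (n - k)" using k r by (simp add: D_def)
    ultimately show ?thesis using k by (simp add: N_def mult.commute)
  qed
  have above: "D * real (n + 1 choose r) = (n + 1) * N"
  proof -
    have "(n + 1 - r) * (n + 1 choose r) = (n + 1) * (n choose r)"
      using binomial_absorb_comp[of "n + 1" r] by simp
    then have "real (n + 1 - r) * real (n + 1 choose r) = real (n + 1) * real (n choose r)"
      by (metis of_nat_mult)
    then show ?thesis using r by (simp add: D_def N_def Suc_diff_le)
  qed
  have count: "card (stable_sets (johnson_adj r) (layer {1..n} r))
    \<le> 2 powr m * (1 + card (layer {1..n} r) / m) powr p"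
  proof (rule card_stable_sets_bound[where x = x and t = "3 * N"])
    fix A assume A: "A \<subseteq> layer {1..n} r" "m < card A"
    then have "A \<noteq> {}" using pos by auto
    then obtain X where X: "X \<in> A"
      and "r\<^sup>2 * card A \<le> (n choose (r - 1)) * (r + card {Y \<in> A. johnson_adj r X Y})"
      using johnson_large_degree[of "{1..n}" A r] A r by auto
    moreover define a d where "a = real (card A)" and "d = real (card {Y \<in> A. johnson_adj r X Y})"
    ultimately have "real r ^ 2 * a \<le> real (n choose (r - 1)) * (r + d)"
      by (simp flip: of_nat_power of_nat_mult of_nat_add)
    then have "real r ^ 2 * a * D \<le> real (n choose (r - 1)) * D * (r + d)"
      using mult_right_mono[of "real r ^ 2 * a" _ D] D by (simp add: mult_ac)
    then have "real r * (r * a * D) \<le> real r * (N * (r + d))"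
      unfolding below by (simp add: power2_eq_square mult_ac)
    then have 1: "r * a * D \<le> N * (r + d)" using pos(1) by simp
    have 2: "(1 + e) * N \<le> a * D"
      using A(2) D by (simp add: m_def a_def field_simps)
    have "x * a = r * a * D / N * (e / (1 + e))" by (simp add: x_def mult_ac)
    also have "e / (1 + e) = 1 - 1 / (1 + e)" using e by (simp add: field_simps)
    also have "r * a * D / N * (1 - 1 / (1 + e)) = r * a * D / N - r * (a * D / ((1 + e) * N))"
      by (simp add: right_diff_distrib diff_divide_distrib mult_ac)
    also have "\<dots> \<le> (real r + d) - real r * 1"
    proof (intro diff_mono mult_left_mono)
      show "r * a * D / N \<le> r + d" using 1 N by (simp add: field_simps)
      show "1 \<le> a * D / ((1 + e) * N)" using 2 N e by simp
    qed simp
    finally have "x * a \<le> d" by simp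
    then show "\<exists>v \<in> A. x * card A \<le> card {w \<in> A. johnson_adj r v w}"
      using X unfolding a_def d_def by blast
  next
    have "m \<le> 2 * N / 1" unfolding m_def using e N D by (intro frac_le mult_right_mono) auto
    then show "m + card (layer {1..n} r) \<le> 3 * N" by (simp add: card_layer N_def)
  next
    define y where "y = p / (3 * N)"
    have xN: "x * N \<le> (real n + 1)\<^sup>2"
    proof -
      have "x * N = r * D * (e / (1 + e))" using N by (simp add: x_def)
      also have "\<dots> \<le> (real n + 1) * (real n + 1) * 1"
        using r D e by (intro mult_mono) auto
      finally show ?thesis by (simp add: power2_eq_square)
    qed
    have "2 / (real n + 1)\<^sup>2 \<le> 2 / (x * N)"
      using xN pos N by (intro divide_left_mono) auto
    also have "\<dots> \<le> (2 * L / 3) / (x * N)"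
      using L pos N by (intro divide_right_mono) auto
    also have "\<dots> = y" by (simp add: y_def p_def)
    finally have y: "2 / (real n + 1)\<^sup>2 \<le> y" .
    moreover have "0 < 2 / (real n + 1)\<^sup>2" by simp
    ultimately have y0: "0 < y" by linarith
    have "L = ln ((real n + 2) ^ 3)" by (simp add: L_def ln_realpow)
    then have expL: "exp L = (real n + 2) ^ 3" by simp
    have "exp (- y) \<le> 1 / (1 + y)"
      using exp_ge_add_one_self[of y] y0 by (simp add: exp_minus field_simps)
    moreover have "exp (- L) \<le> y / (1 + y)"
    proof -
      have "1 \<le> 2 / (real n + 1)\<^sup>2 * ((real n + 2) ^ 3 - 1)"
        by (simp add: divide_simps) (simp add: power2_eq_square power3_eq_cube algebra_simps)
      also have "\<dots> \<le> y * ((real n + 2) ^ 3 - 1)"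
        using y by (intro mult_right_mono) auto
      finally have "1 + y \<le> y * exp L" by (simp add: expL algebra_simps)
      then show ?thesis using y0 by (simp add: exp_minus field_simps)
    qed
    moreover have "1 / (1 + y) + y / (1 + y) = 1" using y0 by (simp add: field_simps)
    ultimately have "exp (- y) + exp (- L) \<le> 1" by linarith
    then show "exp (- (p / (3 * N))) + exp (- (x * p / 2)) \<le> 1"
      using pos by (simp add: y_def p_def)
  qed (use pos p in auto)
  have "1 + card (layer {1..n} r) / m = 1 + D / (1 + e)"
    using N e D by (simp add: card_layer m_def N_def)
  also have "\<dots> \<le> real n + 1"
    using D e frac_le[of "real n" D 1 "1 + e"] by simp
  finally have base: "1 + card (layer {1..n} r) / m \<le> real n + 1" .
  have "2 powr m * (1 + card (layer {1..n} r) / m) powr p \<le> 2 powr m * (real n + 1) powr p"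
    using base p pos by (intro mult_left_mono powr_mono2) auto
  also have "(real n + 1) powr p = 2 powr (log 2 (n + 1) * p)"
    by (simp add: powr_powr[symmetric] add.commute)
  also have "2 powr m * 2 powr (log 2 (n + 1) * p) = 2 powr (m + log 2 (n + 1) * p)"
    by (simp add: powr_add)
  finally have "card (stable_sets (johnson_adj r) (layer {1..n} r)) \<le> 2 powr (m + log 2 (n + 1) * p)"
    using count by linarith
  also have "\<dots> \<le> 2 powr (B / (n + 1) * (1 + e + 48 * ln (n + 2) * log 2 (n + 1) / (e * (n + 2))))"
  proof (intro powr_mono)
    have ND: "N / D = real (n + 1 choose r) / (n + 1)" using above D by (simp add: field_simps)
    have "m = (1 + e) * (N / D)" by (simp add: m_def)
    also have "\<dots> \<le> (1 + e) * (B / (n + 1))"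
      unfolding ND using B e by (intro mult_left_mono divide_right_mono) auto
    finally have mB: "m \<le> B / (n + 1) * (1 + e)" by (simp add: mult.commute)
    have "(r + 1) * (n + 2 choose (r + 1)) = (n + 2) * (n + 1 choose r)"
      using Suc_times_binomial_eq[of "n + 1" r] by (simp add: mult_ac)
    then have "real (r + 1) * real (n + 2 choose (r + 1)) = real (n + 2) * real (n + 1 choose r)"
      by (metis of_nat_mult)
    moreover have "real (n + 2 choose (r + 1)) \<le> 2 * B"
      using B[of r] B[of "r + 1"] by simp
    moreover have "real (r + 1) \<le> 2 * r" using r by simp
    ultimately have "real (n + 2) * real (n + 1 choose r) \<le> 2 * r * (2 * B)"
      using mult_mono[of "real (r + 1)" "2 * r" "real (n + 2 choose (r + 1))" "2 * B"] by simp
    then have Cr: "real (n + 1 choose r) / r \<le> 4 * B / (n + 2)"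
      using pos(1) by (simp add: field_simps)
    have "p = 6 * ln (n + 2) / e * (1 + e) * (N / D / r)"
      using N D pos e by (simp add: p_def x_def L_def field_simps)
    also have "\<dots> = 6 * ln (n + 2) / e * (1 + e) * (real (n + 1 choose r) / r / (n + 1))"
      unfolding ND by simp
    also have "\<dots> \<le> 6 * ln (n + 2) / e * 2 * (4 * B / (n + 2) / (n + 1))"
      using Cr e by (intro mult_mono divide_right_mono) auto
    also have "\<dots> = B / (n + 1) * (48 * ln (n + 2) / (e * (n + 2)))"
      by (simp add: mult_ac)
    finally have "log 2 (n + 1) * p \<le> log 2 (n + 1) * (B / (n + 1) * (48 * ln (n + 2) / (e * (n + 2))))"
      by (intro mult_left_mono) auto
    moreover have "B / (n + 1) * (1 + e + 48 * ln (n + 2) * log 2 (n + 1) / (e * (n + 2)))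
        = B / (n + 1) * (1 + e) + log 2 (n + 1) * (B / (n + 1) * (48 * ln (n + 2) / (e * (n + 2))))"
      by (simp only: distrib_left) (simp add: mult_ac)
    ultimately show "m + log 2 (n + 1) * p
        \<le> B / (n + 1) * (1 + e + 48 * ln (n + 2) * log 2 (n + 1) / (e * (n + 2)))"
      using mB by linarith
  qed simp
  finally show ?thesis by (simp only: of_nat_add of_nat_1 of_nat_numeral)
qed

text \<open>Rank \<open>0\<close> escapes the previous lemma, but there the Johnson graph has a single vertex and hence
  two stable sets.  This and the sum over all ranks account for the two extra summands.\<close>

lemma log_num_sparse_paving_le:
  fixes e B :: real
  assumes e: "0 < e" "e \<le> 1"
    and B: "\<And>k. real (n + 1 choose k) \<le> B"
  shows "log 2 (num_sparse_paving n) \<le>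
    B / (n + 1) * (1 + e + 48 * ln (n + 2) * log 2 (n + 1) / (e * (n + 2))) + log 2 (n + 1) + 1"
    (is "_ \<le> ?Q + _ + 1")
proof (cases "num_sparse_paving n = 0")
  case True
  have "0 \<le> B" using B[of 0] by simp
  then have "0 \<le> ?Q" using e by (intro mult_nonneg_nonneg divide_nonneg_nonneg add_nonneg_nonneg) auto
  moreover have "0 \<le> log 2 (n + 1)" by simp
  ultimately show ?thesis unfolding True by (simp add: log_def)
next
  case False
  have "0 \<le> B" using B[of 0] by simp
  then have Q: "0 \<le> ?Q" using e by (intro mult_nonneg_nonneg divide_nonneg_nonneg add_nonneg_nonneg) auto
  have "real (card (stable_sets (johnson_adj r) (layer {1..n} r))) \<le> 2 * 2 powr ?Q" if "r \<le> n" for r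
  proof (cases "r = 0")
    case True
    have "card (stable_sets (johnson_adj 0) (layer {1..n} 0)) \<le> card (Pow (layer {1..n} 0))"
      by (intro card_mono) (auto simp: stable_sets_def)
    then have "real (card (stable_sets (johnson_adj 0) (layer {1..n} 0))) \<le> 2"
      by (simp add: card_Pow card_layer)
    moreover have "1 \<le> 2 powr ?Q" using Q by (simp add: ge_one_powr_ge_zero)
    ultimately show ?thesis unfolding True by linarith
  next
    case False
    then have "real (card (stable_sets (johnson_adj r) (layer {1..n} r))) \<le> 2 powr ?Q"
      using card_johnson_stable_sets[OF _ that e B] by simp
    also have "\<dots> \<le> 2 * 2 powr ?Q" by simp
    finally show ?thesis .
  qed
  then have "(\<Sum>r\<le>n. real (card (stable_sets (johnson_adj r) (layer {1..n} r))))
      \<le> (\<Sum>r\<le>n. 2 * 2 powr ?Q)"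
    by (intro sum_mono) auto
  then have "real (num_sparse_paving n) \<le> (n + 1) * (2 * 2 powr ?Q)"
    using num_sparse_paving_le[of n] by (simp flip: of_nat_sum)
  then have "log 2 (num_sparse_paving n) \<le> log 2 ((n + 1) * (2 * 2 powr ?Q))"
    using False by (subst log_le_cancel_iff) auto
  also have "\<dots> = log 2 (n + 1) + (1 + ?Q)"
    by (simp add: log_mult)
  finally show ?thesis by (simp add: add_ac)
qed

theorem theorem6:
  "\<exists>\<epsilon> :: nat \<Rightarrow> real. \<epsilon> \<longlonglongrightarrow> 0 \<and>
     (\<forall>n \<ge> 1. log 2 (log 2 (real (num_sparse_paving n))) \<le>
        real n - 3 / 2 * log 2 (real n) + 1 / 2 * log 2 (2 / pi) + 1 + \<epsilon> n)"
proof -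
  (* U is the main term of the bound on the logarithm; delta collects the relative errors from the
     container size, from the branching, and from the union over all ranks.  Any e in (0, 1]
     that tends to 0 more slowly than (ln n)^2 / n would do. *)
  define U where "U = (\<lambda>n::nat. 2 ^ (n + 1) * sqrt (2 / (pi * (n + 1))) / (real n + 1))"
  define e where "e = (\<lambda>n::nat. 1 / sqrt (real n + 2))"
  define \<delta> where "\<delta> = (\<lambda>n::nat. e n + 48 * ln (n + 2) * log 2 (n + 1) / (e n * (n + 2))
    + (log 2 (n + 1) + 1) / U n)"
  have U: "0 < U n" for n by (simp add: U_def)
  have e: "0 < e n" "e n \<le> 1" for n by (simp_all add: e_def)
  have \<delta>: "0 \<le> \<delta> n" for n
    using e[of n] U[of n] by (auto simp: \<delta>_def intro!: add_nonneg_nonneg divide_nonneg_nonneg mult_nonneg_nonneg)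
  have "\<delta> \<longlonglongrightarrow> 0"
    unfolding \<delta>_def e_def U_def by real_asymp
  then have "(\<lambda>n. log 2 (1 + \<delta> n)) \<longlonglongrightarrow> log 2 (1 + 0)"
    by (intro tendsto_intros) auto
  moreover have "log 2 (log 2 (real (num_sparse_paving n))) \<le>
      real n - 3 / 2 * log 2 (real n) + 1 / 2 * log 2 (2 / pi) + 1 + log 2 (1 + \<delta> n)"
    if n: "1 \<le> n" for n
  proof -
    have "log 2 (num_sparse_paving n) \<le> U n * (1 + e n + 48 * ln (n + 2) * log 2 (n + 1) / (e n * (n + 2)))
        + log 2 (n + 1) + 1"
      using log_num_sparse_paving_le[OF e[of n], of n "2 ^ (n + 1) * sqrt (2 / (pi * (n + 1)))"]
        binomial_upper_bound[of "n + 1"] by (simp add: U_def add_ac)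
    also have "\<dots> = U n * (1 + \<delta> n)"
      using U[of n] by (simp add: \<delta>_def field_simps)
    finally have le: "log 2 (num_sparse_paving n) \<le> U n * (1 + \<delta> n)" .
    (* the logarithm of 0 is 0, so the case of a vanishing inner logarithm needs a bound that is at least 1 *)
    have "U n * \<delta> n = U n * (e n + 48 * ln (n + 2) * log 2 (n + 1) / (e n * (n + 2))) + (log 2 (n + 1) + 1)"
      using U[of n] by (simp add: \<delta>_def field_simps)
    moreover have "0 \<le> U n * (e n + 48 * ln (n + 2) * log 2 (n + 1) / (e n * (n + 2)))"
      using e[of n] U[of n] by (intro mult_nonneg_nonneg add_nonneg_nonneg divide_nonneg_nonneg) auto
    moreover have "0 \<le> log 2 (n + 1)" by simp
    moreover have "U n * (1 + \<delta> n) = U n + U n * \<delta> n" by (simp add: distrib_left)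
    ultimately have one: "1 \<le> U n * (1 + \<delta> n)"
      using U[of n] by linarith
    have "log 2 (log 2 (num_sparse_paving n)) \<le> log 2 (U n * (1 + \<delta> n))"
    proof (cases "0 < log 2 (real (num_sparse_paving n))")
      case True
      then show ?thesis using le by (subst log_le_cancel_iff) auto
    next
      case False
      consider "num_sparse_paving n = 0" | "num_sparse_paving n = 1" | "1 < num_sparse_paving n"
        by linarith
      then have "log 2 (real (num_sparse_paving n)) = 0"
        using False by cases (simp_all add: log_def[of 2 0])
      then show ?thesis using one by (simp add: log_def[of 2 0])
    qed
    also have "\<dots> = log 2 (U n) + log 2 (1 + \<delta> n)"
      using U[of n] \<delta>[of n] by (simp add: log_mult add_nonneg_eq_0_iff)
    also have "log 2 (U n) = (n + 1) + 1 / 2 * log 2 (2 / pi) - 3 / 2 * log 2 (n + 1)"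
    proof -
      have "log 2 (sqrt (2 / (pi * (n + 1)))) = 1 / 2 * log 2 (2 / (pi * (n + 1)))"
        by (simp add: log_def ln_sqrt)
      also have "log 2 (2 / (pi * (n + 1))) = log 2 (2 / pi) - log 2 (n + 1)"
        by (simp add: log_divide log_mult)
      finally have sq: "log 2 (sqrt (2 / (pi * (n + 1)))) = 1 / 2 * (log 2 (2 / pi) - log 2 (n + 1))" .
      have "0 < sqrt (2 / (pi * (n + 1)))" by simp
      then have "log 2 (U n) = log 2 (2 ^ (n + 1)) + log 2 (sqrt (2 / (pi * (n + 1)))) - log 2 (real n + 1)"
        unfolding U_def by (subst log_divide; simp add: log_mult)
      moreover have "log 2 (2 ^ (n + 1)) = n + 1" by (subst log_nat_power) simp_all
      ultimately show ?thesis unfolding sq by (simp add: algebra_simps)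
    qed
    also have "\<dots> \<le> (n + 1) + 1 / 2 * log 2 (2 / pi) - 3 / 2 * log 2 n"
      using n by simp
    finally show ?thesis by simp
  qed
  ultimately show ?thesis by (intro exI[of _ "\<lambda>n. log 2 (1 + \<delta> n)"]) auto
qed

end
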